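(* Let $X$ be a Banach space (real or complex) that contains a boundedly complete basic sequence. Then for some $\varepsilon>0$ the unit sphere of $X$ contains a symmetrically $(1+\varepsilon)$-separated sequence.
   Context: A basic sequence $(e_j)_{j=1}^\infty$ in a Banach space $X$ (a Schauder basis of its closed linear span) is boundedly complete if the series $\sum_{j=1}^\infty a^j e_j$ converges in $X$ for every choice of scalars $(a^j)_{j=1}^\infty$ such that $\sup_{k\in\mathbb N}\left\|\sum_{j=1}^k a^je_j\right\|<\infty$. For $\delta>0$, a sequence $(x_n)$ is symmetrically $\delta$-separated if $\|x_n\pm x_k\|\ge\delta$ (both signs) for all $n\neq k$. *)

theory Defs
  imports "HOL-Analysis.Analysis"
begin

text \<open>
  The class \<open>banach\<close> covers real Banach spaces. A complex Banach space is rendered as a type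
  of this class together with a complex scalar multiplication that extends the real one and for
  which the norm is homogeneous.
\<close>

locale complex_banach_space = vector_space cscale
  for cscale :: "complex \<Rightarrow> 'a::banach \<Rightarrow> 'a" +
  assumes cscale_of_real: "cscale (of_real r) x = r *\<^sub>R x"
    and norm_cscale: "norm (cscale c x) = cmod c * norm x"

text \<open>
  The notions below that depend on the scalar field take the scalar multiplication as a
  parameter, so that they apply to real and to complex spaces. Sequences are indexed from 0.
\<close>

definition schauder_basis_of ::
  "('k::real_normed_field \<Rightarrow> 'a::real_normed_vector \<Rightarrow> 'a) \<Rightarrow> (nat \<Rightarrow> 'a) \<Rightarrow> 'a set \<Rightarrow> bool"
  where "schauder_basis_of smul e Y \<longleftrightarrow>
    range e \<subseteq> Y \<and> (\<forall>y\<in>Y. \<exists>!a. (\<lambda>j. smul (a j) (e j)) sums y)"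

definition basic_sequence ::
  "('k::real_normed_field \<Rightarrow> 'a::real_normed_vector \<Rightarrow> 'a) \<Rightarrow> (nat \<Rightarrow> 'a) \<Rightarrow> bool"
  where "basic_sequence smul e \<longleftrightarrow>
    schauder_basis_of smul e (closure (module.span smul (range e)))"

definition boundedly_complete ::
  "('k::real_normed_field \<Rightarrow> 'a::real_normed_vector \<Rightarrow> 'a) \<Rightarrow> (nat \<Rightarrow> 'a) \<Rightarrow> bool"
  where "boundedly_complete smul e \<longleftrightarrow>
    (\<forall>a. bdd_above (range (\<lambda>k. norm (\<Sum>j\<le>k. smul (a j) (e j)))) \<longrightarrow>
      summable (\<lambda>j. smul (a j) (e j)))"

definition symmetrically_separated :: "real \<Rightarrow> (nat \<Rightarrow> 'a::real_normed_vector) \<Rightarrow> bool"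
  where "symmetrically_separated \<delta> x \<longleftrightarrow>
    (\<forall>n k. n \<noteq> k \<longrightarrow> norm (x n + x k) \<ge> \<delta> \<and> norm (x n - x k) \<ge> \<delta>)"

end

theory Submission imports Defs begin

text \<open>
  Normalise the basic sequence and suppose that the sphere has no symmetrically
  \<open>(1+\<epsilon>)\<close>-separated sequence for any \<open>\<epsilon> > 0\<close>. Consider ultrafilters on finitely supported
  \<open>{-1,0,1}\<close>-valued coefficient sequences that lie arbitrarily far out and give combinations of norm
  at most 1 in the limit. If \<open>p\<close> is one of them, then for some sign \<open>s\<close> so is its double
  \<open>p \<oplus> s p\<close>, for otherwise one could choose a separated sequence along \<open>p\<close>. By bounded
  completeness, the tree of coefficient sequences whose partial sums are bounded by twice the basis
  constant is well founded. The rank of an ultrafilter \<open>p\<close>, the least rank of a subtree generated by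
  a member of \<open>p\<close>, strictly increases under doubling, while limits of ultrafilters do not lose rank.
  So there are ultrafilters whose rank is at least that of any node, in particular of the root,
  and doubling once more exceeds the rank of the whole tree.
\<close>

subsection \<open>Ultrafilters\<close>

definition ultra :: "'a filter \<Rightarrow> bool"
  where "ultra p \<longleftrightarrow> p \<noteq> bot \<and> (\<forall>P. eventually P p \<or> eventually (\<lambda>x. \<not> P x) p)"

text \<open>Zorn's lemma yields a minimal proper filter below \<open>F\<close>; infima of chains
  remain proper. Minimality makes it decide every \<open>P\<close>: if it meets \<open>P\<close>
  properly, it equals its restriction to \<open>P\<close>.\<close>

lemma ultra_exists:
  fixes F :: "'a filter"
  assumes "F \<noteq> bot"
  obtains p where "p \<le> F" "ultra p"
proof -
  define A where "A = {G. G \<noteq> bot \<and> G \<le> F}"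
  have po: "partial_order_on A (relation_of (\<lambda>a b. b \<le> a) A)"
    by (auto simp: partial_order_on_def preorder_on_def relation_of_def refl_on_def trans_def antisym_def)
  have "\<exists>m\<in>A. \<forall>a\<in>A. a \<le> m \<longrightarrow> a = m"
  proof (rule predicate_Zorn[OF po])
    fix C assume "C \<in> Chains (relation_of (\<lambda>a b. b \<le> a) A)"
    then have sub: "C \<subseteq> A" and tot: "\<And>a b. a \<in> C \<Longrightarrow> b \<in> C \<Longrightarrow> a \<le> b \<or> b \<le> a"
      unfolding Chains_def relation_of_def by blast+
    show "\<exists>u\<in>A. \<forall>a\<in>C. u \<le> a"
    proof (cases "C = {}")
      case True
      then show ?thesis using assms unfolding A_def by auto
    next
      case False
      have ev: "eventually P (Inf C) \<longleftrightarrow> (\<exists>b\<in>C. eventually P b)" for P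
        by (rule eventually_Inf_base[OF False]) (use tot in \<open>metis inf.absorb1 inf.absorb2 order_refl\<close>)
      have "Inf C \<noteq> bot"
        using ev[of "\<lambda>_. False"] sub unfolding A_def trivial_limit_def by auto
      moreover have "Inf C \<le> F"
        using False sub unfolding A_def by (metis (no_types, lifting) Inf_lower2 ex_in_conv mem_Collect_eq subsetD)
      ultimately have "Inf C \<in> A" unfolding A_def by auto
      then show ?thesis by (intro bexI[of _ "Inf C"]) (auto intro: Inf_lower)
    qed
  qed
  then obtain m where m: "m \<noteq> bot" "m \<le> F" and max: "\<And>a. a \<noteq> bot \<Longrightarrow> a \<le> m \<Longrightarrow> a = m"
    unfolding A_def by auto
  have "eventually P m \<or> eventually (\<lambda>x. \<not> P x) m" for P
  proof (cases "inf m (principal {x. P x}) = bot")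
    case True
    then have "eventually (\<lambda>x. \<not> P x) m"
      by (simp add: trivial_limit_def eventually_inf_principal)
    then show ?thesis ..
  next
    case False
    from max[OF False] have "m \<le> principal {x. P x}" by (metis inf.cobounded1 inf.cobounded2)
    then show ?thesis by (simp add: le_principal)
  qed
  with m that show ?thesis unfolding ultra_def by blast
qed

lemma ultra_not_eventually:
  "ultra p \<Longrightarrow> eventually (\<lambda>x. \<not> P x) p \<longleftrightarrow> \<not> eventually P p"
  unfolding ultra_def trivial_limit_def
  using eventually_conj[of P p "\<lambda>x. \<not> P x"] by auto

lemma ultra_eventuallyD: "ultra p \<Longrightarrow> eventually P p \<Longrightarrow> \<exists>x. P x"
  unfolding ultra_def by (metis eventually_happens)

text \<open>The limit of the filters \<open>f x\<close> along \<open>p\<close>, that is, monadic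
  bind. It serves both for choosing \<open>y\<close> after \<open>x\<close> and for limits of
  ultrafilters.\<close>

definition fbind :: "'a filter \<Rightarrow> ('a \<Rightarrow> 'b filter) \<Rightarrow> 'b filter"
  where "fbind p f = Abs_filter (\<lambda>P. eventually (\<lambda>x. eventually P (f x)) p)"

lemma eventually_fbind:
  fixes f :: "'a \<Rightarrow> 'b filter"
  shows
  "eventually P (fbind p f) \<longleftrightarrow> eventually (\<lambda>x. eventually P (f x)) p"
  unfolding fbind_def
proof (rule eventually_Abs_filter, rule is_filter.intro)
  fix P Q :: "'b \<Rightarrow> bool"
  show "\<forall>\<^sub>F x in p. \<forall>\<^sub>F y in f x. P y \<and> Q y"
    if "\<forall>\<^sub>F x in p. \<forall>\<^sub>F y in f x. P y" "\<forall>\<^sub>F x in p. \<forall>\<^sub>F y in f x. Q y"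
    using that by eventually_elim (rule eventually_conj)
  show "\<forall>\<^sub>F x in p. \<forall>\<^sub>F y in f x. Q y"
    if "\<forall>y. P y \<longrightarrow> Q y" "\<forall>\<^sub>F x in p. \<forall>\<^sub>F y in f x. P y"
    using that(2) by eventually_elim (use that(1) in \<open>auto elim: eventually_mono\<close>)
qed auto

lemma ultra_fbind:
  assumes "ultra p" "\<forall>\<^sub>F x in p. ultra (f x)"
  shows "ultra (fbind p f)"
proof -
  have eq: "(\<forall>\<^sub>F x in p. \<forall>\<^sub>F y in f x. \<not> P y) \<longleftrightarrow> (\<forall>\<^sub>F x in p. \<not> (\<forall>\<^sub>F y in f x. P y))" for P
    by (rule eventually_subst) (use assms(2) in \<open>eventually_elim, simp add: ultra_not_eventually\<close>)
  have "\<not> (\<forall>\<^sub>F x in p. \<forall>\<^sub>F y in f x. False)"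
    using eq[of "\<lambda>_. True"] ultra_not_eventually[OF assms(1), of "\<lambda>_. True"] by simp
  then show ?thesis
    using eq ultra_not_eventually[OF assms(1)]
    by (auto simp: ultra_def trivial_limit_def eventually_fbind)
qed

lemma ultra_filtermap: "ultra p \<Longrightarrow> ultra (filtermap f p)"
  unfolding ultra_def by (simp add: eventually_filtermap filtermap_bot_iff)

subsection \<open>Comparison of ranks\<close>

text \<open>
  For well-founded relations, \<open>sim R S w v\<close> says that the rank of \<open>w\<close> under \<open>R\<close> is at most the rank of \<open>v\<close>
  under \<open>S\<close>; this replaces ordinals.
\<close>

inductive sim :: "('a \<Rightarrow> 'a \<Rightarrow> bool) \<Rightarrow> ('b \<Rightarrow> 'b \<Rightarrow> bool) \<Rightarrow> 'a \<Rightarrow> 'b \<Rightarrow> bool"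
  for R S where
  simI: "\<forall>w'. R w' w \<longrightarrow> (\<exists>v'. S v' v \<and> sim R S w' v') \<Longrightarrow> sim R S w v"

lemma simD: "sim R S w v \<Longrightarrow> R w' w \<Longrightarrow> \<exists>v'. S v' v \<and> sim R S w' v'"
  by (erule sim.cases) blast

lemma sim_trans: "sim R S w v \<Longrightarrow> sim S T v z \<Longrightarrow> sim R T w z"
proof (induction arbitrary: z rule: sim.induct)
  case (simI w v)
  show ?case
  proof (intro sim.simI allI impI)
    fix w' assume "R w' w"
    with simI.IH obtain v' where v': "S v' v" "\<And>z. sim S T v' z \<Longrightarrow> sim R T w' z" by blast
    from simD[OF simI.prems v'(1)] v'(2) show "\<exists>z'. T z' z \<and> sim R T w' z'" by blast
  qed
qed

text \<open>Transports a rank bound along a map \<open>f\<close> between trees; the invariant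
  \<open>I\<close> restricts attention to the part reached from \<open>v\<close>.\<close>

lemma sim_map:
  assumes "sim R S w v" "I v"
    and "\<And>v v'. I v \<Longrightarrow> S v' v \<Longrightarrow> I v' \<and> S' (f v') (f v)"
  shows "sim R S' w (f v)"
  using assms(1,2)
proof (induction rule: sim.induct)
  case (simI w v)
  then show ?case by (intro sim.simI allI impI) (meson assms(3))
qed

text \<open>If \<open>w\<close> is not dominated by \<open>v\<close>, some child \<open>w'\<close>
  is dominated by no child of \<open>v\<close>; by induction \<open>w'\<close> then dominates all of
  them.\<close>

lemma sim_total:
  assumes "wfP R"
  shows "sim R R w v \<or> sim R R v w"
proof (induction w arbitrary: v rule: wfp_induct_rule[OF assms])
  case (1 w)
  show ?case
  proof (cases "sim R R w v")
    case False
    then obtain w' where w': "R w' w" "\<And>v'. R v' v \<Longrightarrow> \<not> sim R R w' v'"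
      using sim.simI[of R w R v] by blast
    have "\<exists>v''. R v'' w \<and> sim R R v' v''" if "R v' v" for v'
      using 1[OF w'(1), of v'] w' that by blast
    then have "sim R R v w"
      using sim.simI[of R v R w] by blast
    then show ?thesis ..
  qed auto
qed

text \<open>If the child \<open>v\<close> dominated its parent \<open>w\<close>, then some child of
  \<open>v\<close> would dominate \<open>v\<close>, which the induction hypothesis excludes.\<close>

lemma sim_irrefl:
  assumes "wfP R" "R v w"
  shows "\<not> sim R R w v"
  using assms(2)
proof (induction w arbitrary: v rule: wfp_induct_rule[OF assms(1)])
  case (1 w)
  show ?case
  proof
    assume "sim R R w v"
    from simD[OF this 1(2)] obtain v' where "R v' v" "sim R R v v'" by blast
    with 1 show False by blast
  qed
qed

subsection \<open>Sequences without separated signed combinations\<close>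

text \<open>For \<open>b <= a\<close> split the combination as \<open>b (x + y) + (a - b) x\<close>;
  the other case is symmetric. This carries a bound for normalised vectors over to their
  multiples.\<close>

lemma norm_combination_le:
  fixes x y :: "'a::real_normed_vector"
  assumes "norm x \<le> 1" "norm y \<le> 1" "norm (x + y) \<le> 1 + \<epsilon>" "\<epsilon> \<ge> 0"
    and "0 \<le> a" "a \<le> M" "0 \<le> b" "b \<le> M"
  shows "norm (a *\<^sub>R x + b *\<^sub>R y) \<le> M * (1 + \<epsilon>)"
proof -
  have *: "norm (a *\<^sub>R x + b *\<^sub>R y) \<le> M * (1 + \<epsilon>)"
    if "norm x \<le> 1" "norm (x + y) \<le> 1 + \<epsilon>" "0 \<le> b" "b \<le> a" "a \<le> M" for a b and x y :: "'a"
  proof -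
    have "a *\<^sub>R x + b *\<^sub>R y = b *\<^sub>R (x + y) + (a - b) *\<^sub>R x"
      by (simp add: algebra_simps)
    then have "norm (a *\<^sub>R x + b *\<^sub>R y) \<le> b * norm (x + y) + (a - b) * norm x"
      using norm_triangle_ineq[of "b *\<^sub>R (x + y)" "(a - b) *\<^sub>R x"] that by simp
    also have "\<dots> \<le> b * (1 + \<epsilon>) + (a - b) * 1"
      using that by (intro add_mono mult_left_mono) auto
    also have "\<dots> \<le> a * (1 + \<epsilon>)"
      using that assms(4) mult_right_mono[of b a \<epsilon>] by (simp add: algebra_simps)
    also have "\<dots> \<le> M * (1 + \<epsilon>)"
      using that assms(4) by (intro mult_right_mono) auto
    finally show ?thesis .
  qed
  show ?thesis
  proof (cases "b \<le> a")
    case True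
    with *[of x y b a] assms show ?thesis by simp
  next
    case False
    with *[of y x a b] assms show ?thesis by (simp add: add.commute)
  qed
qed

text \<open>The situation to be refuted. Coefficients are real because only signs will occur, so
  real and complex spaces are treated at once. \<open>K\<close> is a basis constant, and bounded
  completeness enters through the convergence of the terms to 0.\<close>

locale unseparated_sequence =
  fixes v :: "nat \<Rightarrow> 'a::real_normed_vector" and K :: real
  assumes norm_v: "\<And>j. norm (v j) = 1"
    and proj: "\<And>(f :: nat \<Rightarrow> real) k m. k \<le> m \<Longrightarrow>
      norm (\<Sum>j<k. f j *\<^sub>R v j) \<le> K * norm (\<Sum>j<m. f j *\<^sub>R v j)"
    and bdd_complete: "\<And>f :: nat \<Rightarrow> real. bdd_above (range (\<lambda>m. norm (\<Sum>j<m. f j *\<^sub>R v j))) \<Longrightarrow>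
      (\<lambda>j. f j *\<^sub>R v j) \<longlonglongrightarrow> 0"
    and no_sep: "\<And>\<epsilon> x. \<epsilon> > 0 \<Longrightarrow> range x \<subseteq> sphere (0::'a) 1 \<Longrightarrow> \<not> symmetrically_separated (1 + \<epsilon>) x"
begin

section \<open>Sign vectors, their combinations and truncations\<close>

definition signed :: "(nat \<Rightarrow> real) \<Rightarrow> bool"
  where "signed f \<longleftrightarrow> (\<forall>j. f j \<in> {-1, 0, 1}) \<and> (\<exists>m. \<forall>j\<ge>m. f j = 0)"

text \<open>Summing over the support avoids choosing a length; for infinite support the sum is 0 by
  convention.\<close>

definition lin_comb :: "(nat \<Rightarrow> real) \<Rightarrow> 'a"
  where "lin_comb f = (\<Sum>j | f j \<noteq> 0. f j *\<^sub>R v j)"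

definition trunc :: "nat \<Rightarrow> (nat \<Rightarrow> real) \<Rightarrow> nat \<Rightarrow> real"
  where "trunc k f = (\<lambda>j. if j < k then f j else 0)"

lemma lin_comb_eq: "\<forall>j\<ge>m. f j = 0 \<Longrightarrow> lin_comb f = (\<Sum>j<m. f j *\<^sub>R v j)"
  unfolding lin_comb_def by (rule sum.mono_neutral_left) (auto simp: not_less[symmetric])

lemma lin_comb_trunc: "lin_comb (trunc k f) = (\<Sum>j<k. f j *\<^sub>R v j)"
  by (subst lin_comb_eq[of k]) (auto simp: trunc_def)

lemma signed_trunc: "signed f \<Longrightarrow> signed (trunc k f)"
  unfolding signed_def trunc_def by auto

lemma norm_lin_comb_trunc:
  assumes "signed f"
  shows "norm (lin_comb (trunc k f)) \<le> K * norm (lin_comb f)"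
proof -
  obtain m where m: "\<forall>j\<ge>m. f j = 0" using assms unfolding signed_def by blast
  then have "lin_comb f = (\<Sum>j<max k m. f j *\<^sub>R v j)" by (intro lin_comb_eq) auto
  then show ?thesis unfolding lin_comb_trunc using proj[of k "max k m" f] by simp
qed

lemma K_ge_1: "K \<ge> 1"
  using proj[of 1 1 "\<lambda>_. 1"] norm_v by simp

text \<open>Truncation just after the first nonzero coefficient leaves a vector of norm 1, which
  \<open>K\<close> times the norm of the whole combination must bound.\<close>

lemma lin_comb_nonzero:
  assumes "signed f" "f \<noteq> (\<lambda>_. 0)"
  shows "lin_comb f \<noteq> 0"
proof
  assume 0: "lin_comb f = 0"
  obtain j0 where j0: "f j0 \<noteq> 0" using assms(2) by auto
  define j where "j = (LEAST j. f j \<noteq> 0)"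
  have j: "f j \<noteq> 0" "\<And>i. i < j \<Longrightarrow> f i = 0"
    unfolding j_def using j0 LeastI[of "\<lambda>j. f j \<noteq> 0"] not_less_Least by blast+
  have "(\<Sum>i<Suc j. f i *\<^sub>R v i) = f j *\<^sub>R v j"
    using j(2) by simp
  with norm_lin_comb_trunc[OF assms(1), of "Suc j"] 0 j(1) norm_v[of j]
  show False unfolding lin_comb_trunc by simp
qed

text \<open>
  These ultrafilters concentrate on nonzero sign vectors that lie arbitrarily far out and whose
  combinations have norm at most 1 in the limit.
\<close>

definition normed_ultra :: "(nat \<Rightarrow> real) filter \<Rightarrow> bool"
  where "normed_ultra p \<longleftrightarrow> ultra p \<and> (\<forall>\<^sub>F f in p. signed f) \<and> (\<forall>m. \<forall>\<^sub>F f in p. \<forall>j<m. f j = 0) \<and>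
    (\<forall>\<^sub>F f in p. f \<noteq> (\<lambda>_. 0)) \<and> (\<forall>\<epsilon>>0. \<forall>\<^sub>F f in p. norm (lin_comb f) \<le> 1 + \<epsilon>)"

lemma normed_ultraD:
  assumes "normed_ultra p"
  shows "ultra p" "\<forall>\<^sub>F f in p. signed f" "\<forall>\<^sub>F f in p. \<forall>j<m. f j = 0"
    "\<forall>\<^sub>F f in p. f \<noteq> (\<lambda>_. 0)" "\<epsilon> > 0 \<Longrightarrow> \<forall>\<^sub>F f in p. norm (lin_comb f) \<le> 1 + \<epsilon>"
  using assms unfolding normed_ultra_def by blast+

text \<open>The unit coefficient vectors, pushed forward along a nonprincipal ultrafilter on the
  indices, give an example.\<close>

lemma normed_ultra_exists: "\<exists>p. normed_ultra p"
proof -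
  obtain q :: "nat filter" where q: "q \<le> sequentially" "ultra q"
    using ultra_exists[OF sequentially_bot] by blast
  define d :: "nat \<Rightarrow> nat \<Rightarrow> real" where "d n = (\<lambda>j. if j = n then 1 else 0)" for n
  have sgnd: "signed (d n)" for n
    unfolding signed_def d_def by (auto intro: exI[of _ "Suc n"])
  have nz: "d n \<noteq> (\<lambda>_. 0)" for n
    unfolding d_def by (auto dest: fun_cong[of _ _ n])
  have tot: "lin_comb (d n) = v n" for n
    by (subst lin_comb_eq[of "Suc n"]) (auto simp: d_def if_distrib[of "\<lambda>c. c *\<^sub>R _"] cong: if_cong)
  have "\<forall>\<^sub>F n in q. \<forall>j<m. d n j = 0" for m
    by (rule filter_leD[OF q(1)])
      (use eventually_ge_at_top[of m] in \<open>eventually_elim, auto simp: d_def\<close>)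
  then have "normed_ultra (filtermap d q)"
    unfolding normed_ultra_def by (simp add: eventually_filtermap ultra_filtermap q(2) sgnd nz tot norm_v)
  then show ?thesis ..
qed

text \<open>
  If neither sign worked, an inductive choice along \<open>p\<close> would produce a separated sequence of
  normalised combinations.
\<close>

lemma sign_exists:
  assumes "normed_ultra p"
  obtains s :: real where "s \<in> {1, -1}"
    "\<And>\<epsilon>. \<epsilon> > 0 \<Longrightarrow> \<forall>\<^sub>F x in p. \<forall>\<^sub>F y in p. norm (sgn (lin_comb x) + s *\<^sub>R sgn (lin_comb y)) \<le> 1 + \<epsilon>"
proof -
  define close where "close s \<epsilon> x y \<longleftrightarrow> norm (sgn (lin_comb x) + s *\<^sub>R sgn (lin_comb y)) \<le> 1 + \<epsilon>"
    for s \<epsilon> :: real and x y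
  note ultra_neg = ultra_not_eventually[OF normed_ultraD(1)[OF assms]]
  have "\<exists>s\<in>{1, -1}. \<forall>\<epsilon>>0. \<forall>\<^sub>F x in p. \<forall>\<^sub>F y in p. close s \<epsilon> x y"
  proof (rule ccontr)
    assume "\<not> ?thesis"
    then obtain \<epsilon>1 \<epsilon>2 where eps: "\<epsilon>1 > 0" "\<epsilon>2 > 0"
      and far1: "\<not> (\<forall>\<^sub>F x in p. \<forall>\<^sub>F y in p. close 1 \<epsilon>1 x y)"
      and far2: "\<not> (\<forall>\<^sub>F x in p. \<forall>\<^sub>F y in p. close (-1) \<epsilon>2 x y)"
      by auto
    define \<epsilon> where "\<epsilon> = min \<epsilon>1 \<epsilon>2"
    have "\<epsilon> > 0" using eps unfolding \<epsilon>_def by simp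
    define far where "far x y \<longleftrightarrow> \<not> close 1 \<epsilon>1 x y \<and> \<not> close (-1) \<epsilon>2 x y" for x y
    define G where "G x \<longleftrightarrow> signed x \<and> x \<noteq> (\<lambda>_. 0) \<and> (\<forall>\<^sub>F y in p. far x y)" for x
    \<comment> \<open>For an ultrafilter, failing to hold almost surely means that the negation
      holds almost surely, so both nested quantifiers can be flipped.\<close>
    have G: "\<forall>\<^sub>F x in p. G x"
      using far1 far2 normed_ultraD(2,4)[OF assms] unfolding ultra_neg[symmetric]
    proof eventually_elim
      case (elim x)
      from elim(1,2) have "\<forall>\<^sub>F y in p. far x y"
        by eventually_elim (simp add: far_def)
      with elim show ?case by (simp add: G_def)
    qed
    \<comment> \<open>Each of the finitely many earlier vectors is far from almost every
      \<open>y\<close>, so a common \<open>y\<close> satisfying \<open>G\<close> is available at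
      every stage.\<close>
    have "\<exists>x. \<forall>n::nat. G (x n) \<and> (\<forall>m<n. far (x m) (x n))"
    proof (rule dependent_wellorder_choice)
      fix n :: nat and x :: "nat \<Rightarrow> nat \<Rightarrow> real"
      assume IH: "\<And>m. m < n \<Longrightarrow> G (x m) \<and> (\<forall>i<m. far (x i) (x m))"
      then have "\<forall>m\<in>{..<n}. \<forall>\<^sub>F y in p. far (x m) y" by (auto simp: G_def)
      then have "\<forall>\<^sub>F y in p. \<forall>m\<in>{..<n}. far (x m) y" by (intro eventually_ball_finite) auto
      with G have "\<forall>\<^sub>F y in p. G y \<and> (\<forall>m<n. far (x m) y)" by eventually_elim auto
      then show "\<exists>r. G r \<and> (\<forall>m<n. far (x m) r)"
        using ultra_eventuallyD[OF normed_ultraD(1)[OF assms]] by blast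
    qed auto
    then obtain x where x: "\<forall>n::nat. G (x n) \<and> (\<forall>m<n. far (x m) (x n))" by (elim exE)
    define z where "z n = sgn (lin_comb (x n))" for n
    have norm_z: "norm (z n) = 1" for n
    proof -
      have "G (x n)" using x by blast
      then have "lin_comb (x n) \<noteq> 0" unfolding G_def using lin_comb_nonzero by blast
      then show ?thesis by (simp add: z_def norm_sgn)
    qed
    have sep: "norm (z m + z n) \<ge> 1 + \<epsilon> \<and> norm (z m - z n) \<ge> 1 + \<epsilon>" if "m < n" for m n
    proof -
      have "far (x m) (x n)" using x that by blast
      then show ?thesis by (auto simp: far_def close_def z_def \<epsilon>_def min_def)
    qed
    have "symmetrically_separated (1 + \<epsilon>) z"
      unfolding symmetrically_separated_def
      by (metis sep nat_neq_iff add.commute norm_minus_commute)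
    with no_sep[of \<epsilon> z] \<open>\<epsilon> > 0\<close> norm_z show False by (auto simp: sphere_def dist_norm)
  qed
  then show ?thesis using that unfolding close_def by blast
qed

text \<open>The distribution of \<open>x + s y\<close> with \<open>y\<close> chosen according to \<open>p\<close> after \<open>x\<close>.\<close>

definition double :: "real \<Rightarrow> (nat \<Rightarrow> real) filter \<Rightarrow> (nat \<Rightarrow> real) filter"
  where "double s p = fbind p (\<lambda>x. filtermap (\<lambda>y j. x j + s * y j) p)"

lemma eventually_double:
  "eventually P (double s p) \<longleftrightarrow> (\<forall>\<^sub>F x in p. \<forall>\<^sub>F y in p. P (\<lambda>j. x j + s * y j))"
  unfolding double_def by (simp add: eventually_fbind eventually_filtermap)

lemma lin_comb_add:
  assumes "\<forall>j\<ge>m. x j = 0" "\<forall>j\<ge>n. y j = 0"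
  shows "lin_comb (\<lambda>j. x j + s * y j) = lin_comb x + s *\<^sub>R lin_comb y"
proof -
  have "lin_comb (\<lambda>j. x j + s * y j) = (\<Sum>j<max m n. (x j + s * y j) *\<^sub>R v j)"
    using assms by (intro lin_comb_eq) auto
  also have "\<dots> = (\<Sum>j<max m n. x j *\<^sub>R v j) + s *\<^sub>R (\<Sum>j<max m n. y j *\<^sub>R v j)"
    by (simp add: scaleR_left_distrib sum.distrib scaleR_sum_right)
  also have "(\<Sum>j<max m n. x j *\<^sub>R v j) = lin_comb x"
    using assms by (intro lin_comb_eq[symmetric]) auto
  also have "(\<Sum>j<max m n. y j *\<^sub>R v j) = lin_comb y"
    using assms by (intro lin_comb_eq[symmetric]) auto
  finally show ?thesis .
qed

text \<open>Once \<open>x\<close> is fixed, almost every \<open>y\<close> vanishes up to the end of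
  the support of \<open>x\<close>. The supports are then disjoint and the sum is again a sign
  vector; closeness of the directions controls its norm.\<close>

lemma normed_ultra_double:
  assumes "normed_ultra p" "s \<in> {1, -1}"
    and close: "\<And>\<epsilon>. \<epsilon> > 0 \<Longrightarrow>
      \<forall>\<^sub>F x in p. \<forall>\<^sub>F y in p. norm (sgn (lin_comb x) + s *\<^sub>R sgn (lin_comb y)) \<le> 1 + \<epsilon>"
  shows "normed_ultra (double s p)"
proof -
  note p = normed_ultraD[OF assms(1)]
  have 1: "ultra (double s p)"
    unfolding double_def by (intro ultra_fbind ultra_filtermap p(1) always_eventually allI)
  have 2: "\<forall>\<^sub>F f in double s p. signed f \<and> f \<noteq> (\<lambda>_. 0)"
    unfolding eventually_double using p(2,4)
  proof eventually_elim
    case (elim x)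
    then obtain m where m: "\<forall>j\<ge>m. x j = 0" unfolding signed_def by blast
    obtain i where i: "x i \<noteq> 0" using elim by auto
    show ?case using p(2) p(3)[of m]
    proof eventually_elim
      case (elim y)
      then obtain n where n: "\<forall>j\<ge>n. y j = 0" unfolding signed_def by blast
      have "x j + s * y j \<in> {-1, 0, 1}" for j
      proof (cases "j < m")
        case True
        then show ?thesis using elim \<open>signed x\<close> by (auto simp: signed_def)
      next
        case False
        then have "x j = 0" "y j \<in> {-1, 0, 1}" using m elim by (auto simp: signed_def)
        then show ?thesis using assms(2) by auto
      qed
      moreover have "\<forall>j\<ge>max m n. x j + s * y j = 0" using m n by auto
      moreover have "x i + s * y i \<noteq> 0"
        using i m elim by (metis add.right_neutral mult_zero_right not_le)
      ultimately show ?case unfolding signed_def fun_eq_iff by blast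
    qed
  qed
  have 3: "\<forall>\<^sub>F f in double s p. \<forall>j<m. f j = 0" for m
    unfolding eventually_double using p(3)[of m]
  proof eventually_elim
    case (elim x)
    from p(3)[of m] show ?case by eventually_elim (use elim in simp)
  qed
  have 4: "\<forall>\<^sub>F f in double s p. norm (lin_comb f) \<le> 1 + \<epsilon>" if "\<epsilon> > 0" for \<epsilon>
  proof -
    \<comment> \<open>The cap at 1 gives \<open>\<delta> * \<delta> <= \<delta>\<close>, hence
      \<open>(1 + \<delta>)^2 <= 1 + 3 * \<delta>\<close>.\<close>
    define \<delta> where "\<delta> = min 1 (\<epsilon> / 3)"
    have \<delta>: "\<delta> > 0" "(1 + \<delta>) * (1 + \<delta>) \<le> 1 + \<epsilon>"
    proof -
      show "\<delta> > 0" using that unfolding \<delta>_def by simp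
      then have "\<delta> * \<delta> \<le> \<delta> * 1" unfolding \<delta>_def by (intro mult_left_mono) auto
      moreover have "3 * \<delta> \<le> \<epsilon>" unfolding \<delta>_def by simp
      ultimately show "(1 + \<delta>) * (1 + \<delta>) \<le> 1 + \<epsilon>" by (simp add: algebra_simps)
    qed
    show ?thesis
      unfolding eventually_double using p(2) p(5)[OF \<delta>(1)] close[OF \<delta>(1)]
    proof eventually_elim
      case (elim x)
      then obtain m where m: "\<forall>j\<ge>m. x j = 0" unfolding signed_def by blast
      show ?case using p(2) p(5)[OF \<delta>(1)] elim(3)
      proof eventually_elim
        case (elim y)
        then obtain n where n: "\<forall>j\<ge>n. y j = 0" unfolding signed_def by blast
        have sgn_eq: "norm w *\<^sub>R sgn w = w" for w :: "'a"
          by (cases "w = 0") (simp_all add: sgn_div_norm)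
        have "lin_comb (\<lambda>j. x j + s * y j) = norm (lin_comb x) *\<^sub>R sgn (lin_comb x) +
            norm (lin_comb y) *\<^sub>R (s *\<^sub>R sgn (lin_comb y))"
          by (subst lin_comb_add[OF m n]) (simp only: sgn_eq scaleR_left_commute[of "norm _" s])
        then have "norm (lin_comb (\<lambda>j. x j + s * y j)) \<le> (1 + \<delta>) * (1 + \<delta>)"
          using norm_combination_le[of "sgn (lin_comb x)" "s *\<^sub>R sgn (lin_comb y)" \<delta> "norm (lin_comb x)" "1 + \<delta>"
              "norm (lin_comb y)"] elim \<open>norm (lin_comb x) \<le> 1 + \<delta>\<close> assms(2) \<delta>(1)
          by (auto simp: norm_sgn)
        with \<delta>(2) show ?case by linarith
      qed
    qed
  qed
  show ?thesis
    unfolding normed_ultra_def using 1 2 3 4 by (auto elim: eventually_mono)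
qed

section \<open>The tree of sign vectors with bounded partial sums\<close>

text \<open>A proper initial segment: the cut must remove a nonzero entry, so every step up the tree
  adds one.\<close>

definition ext :: "(nat \<Rightarrow> real) \<Rightarrow> (nat \<Rightarrow> real) \<Rightarrow> bool"
  where "ext f g \<longleftrightarrow> (\<exists>k. f = trunc k g \<and> (\<exists>j\<ge>k. g j \<noteq> 0))"

text \<open>The bound \<open>2 * K\<close> is the one obeyed by truncations of signed combinations
  of norm at most 2.\<close>

definition bounded_sums :: "(nat \<Rightarrow> real) \<Rightarrow> bool"
  where "bounded_sums f \<longleftrightarrow> signed f \<and> (\<forall>k. norm (lin_comb (trunc k f)) \<le> 2 * K)"

definition bounded_ext :: "(nat \<Rightarrow> real) \<Rightarrow> (nat \<Rightarrow> real) \<Rightarrow> bool"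
  where "bounded_ext g f \<longleftrightarrow> bounded_sums g \<and> ext f g"

text \<open>The tree of truncations of members of \<open>D\<close>. The longer sequence is the first
  argument, so that well-foundedness excludes infinite extension.\<close>

definition ext_in :: "((nat \<Rightarrow> real) \<Rightarrow> bool) \<Rightarrow> (nat \<Rightarrow> real) \<Rightarrow> (nat \<Rightarrow> real) \<Rightarrow> bool"
  where "ext_in D g f \<longleftrightarrow> ext f g \<and> (\<exists>d k. D d \<and> g = trunc k d)"

lemma trunc_trunc: "trunc k (trunc l f) = trunc (min k l) f"
  unfolding trunc_def by auto

text \<open>An infinite branch would be a coefficient sequence with bounded partial sums whose terms do not tend to 0.\<close>

lemma wfp_bounded_ext: "wfP bounded_ext"
  unfolding wfp_def wf_iff_no_infinite_down_chain
proof
  assume "\<exists>F. \<forall>i. (F (Suc i), F i) \<in> {(x, y). bounded_ext x y}"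
  then obtain F where F: "\<And>i. bounded_sums (F (Suc i))" "\<And>i. ext (F i) (F (Suc i))"
    unfolding bounded_ext_def by blast
  from F(2) obtain k l where k: "\<And>i. F i = trunc (k i) (F (Suc i))"
    and l: "\<And>i. l i \<ge> k i" "\<And>i. F (Suc i) (l i) \<noteq> 0"
    unfolding ext_def by metis
  \<comment> \<open>The nonzero entry at \<open>l i\<close> survives the next cut, so the cut points
    strictly increase.\<close>
  have "l i < k (Suc i)" for i
    using l(2)[of i] k[of "Suc i"] unfolding trunc_def by (metis (mono_tags, lifting))
  then have k_mono: "k i < k (Suc i)" for i
    using l(1)[of i] by (meson le_less_trans)
  then have sm: "strict_mono k" by (simp add: strict_mono_Suc_iff)
  have stab: "F (i + n) j = F i j" if "j < k i" for i n j
  proof (induction n)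
    case (Suc n)
    have "j < k (i + n)"
      using that sm by (meson le_add1 less_le_trans strict_mono_leD)
    then show ?case using Suc k[of "i + n"] unfolding trunc_def by (metis add_Suc_right)
  qed simp
  \<comment> \<open>The limit of the branch, read off diagonally: stage \<open>Suc j\<close> has its
    cut beyond \<open>j\<close>, so entry \<open>j\<close> no longer changes.\<close>
  define f where "f j = F (Suc j) j" for j
  have f_eq: "f j = F i j" if "j < k i" for i j
  proof -
    have "j < k (Suc j)" using strict_mono_imp_increasing[OF sm, of "Suc j"] by simp
    then show ?thesis
      using stab[OF that, of "Suc j"] stab[of j "Suc j" i] by (simp add: f_def add.commute)
  qed
  have "norm (\<Sum>j<m. f j *\<^sub>R v j) \<le> 2 * K" for m
  proof -
    have "m \<le> k (Suc m)" using strict_mono_imp_increasing[OF sm, of "Suc m"] by simp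
    then have "(\<Sum>j<m. f j *\<^sub>R v j) = lin_comb (trunc m (F (Suc m)))"
      unfolding lin_comb_trunc by (intro sum.cong refl) (auto simp: f_eq[of _ "Suc m"])
    with F(1)[of m] show ?thesis unfolding bounded_sums_def by simp
  qed
  then have "(\<lambda>j. f j *\<^sub>R v j) \<longlonglongrightarrow> 0"
    by (intro bdd_complete bdd_aboveI2)
  then have "(\<lambda>j. norm (f j *\<^sub>R v j)) \<longlonglongrightarrow> 0"
    by (rule tendsto_norm_zero)
  then have "\<forall>\<^sub>F j in sequentially. norm (f j *\<^sub>R v j) < 1"
    by (rule order_tendstoD) simp
  then obtain N where N: "\<And>j. j \<ge> N \<Longrightarrow> norm (f j *\<^sub>R v j) < 1"
    unfolding eventually_sequentially by blast
  have "N \<le> l N" using l(1)[of N] strict_mono_imp_increasing[OF sm, of N] by simp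
  moreover have "f (l N) = F (Suc N) (l N)" by (rule f_eq) fact
  moreover have "F (Suc N) (l N) \<in> {-1, 1}"
    using F(1)[of N] l(2)[of N] unfolding bounded_sums_def signed_def by auto
  ultimately show False using N[of "l N"] norm_v by auto
qed

text \<open>
  Quantified over all \<open>D\<close> in an ultrafilter, \<open>sim bounded_ext (ext_in D) w (\<lambda>_. 0)\<close> says that the
  ultrafilter has rank at least that of \<open>w\<close>. Doubling strictly increases this rank: a typical \<open>x\<close> is
  a proper initial segment, and the tree above it again contains a copy of the tree of \<open>p\<close>.
\<close>

lemma rank_less_double:
  assumes "normed_ultra p" "s \<in> {1, -1}"
    and rank: "\<And>D. eventually D p \<Longrightarrow> sim bounded_ext (ext_in D) w (\<lambda>_. 0)"
    and D: "eventually D (double s p)"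
  shows "\<exists>x. ext_in D x (\<lambda>_. 0) \<and> sim bounded_ext (ext_in D) w x"
proof -
  note p = normed_ultraD[OF assms(1)]
  have "\<forall>\<^sub>F x in p. signed x \<and> x \<noteq> (\<lambda>_. 0) \<and> (\<forall>\<^sub>F y in p. D (\<lambda>j. x j + s * y j))"
    using D p(2,4) unfolding eventually_double by eventually_elim simp
  from ultra_eventuallyD[OF p(1) this] obtain x where x: "signed x" "x \<noteq> (\<lambda>_. 0)"
    and Dx: "\<forall>\<^sub>F y in p. D (\<lambda>j. x j + s * y j)" by blast
  obtain m where m: "\<forall>j\<ge>m. x j = 0" using x unfolding signed_def by blast
  \<comment> \<open>The section of \<open>D\<close> over \<open>x\<close>, restricted to vectors
    starting after \<open>x\<close> ends; it is still large for \<open>p\<close>.\<close>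
  define D' where "D' y \<longleftrightarrow> D (\<lambda>j. x j + s * y j) \<and> (\<forall>j<m. y j = 0)" for y
  have D': "eventually D' p"
    unfolding D'_def using Dx p(3)[of m] by eventually_elim simp
  define I where "I t \<longleftrightarrow> (\<forall>j<m. t j = 0)" for t :: "nat \<Rightarrow> real"
  \<comment> \<open>This shift embeds the tree of \<open>D'\<close> into the part of the tree of
    \<open>D\<close> above \<open>x\<close>, sending the root to \<open>x\<close>.\<close>
  define \<phi> where "\<phi> t = (\<lambda>j. x j + s * t j)" for t
  have s: "s \<noteq> 0" using assms(2) by auto
  have step: "I t' \<and> ext_in D (\<phi> t') (\<phi> t)" if It: "I t" and tt: "ext_in D' t' t" for t t'
  proof -
    obtain d k where d: "D' d" "t' = trunc k d"
      using tt unfolding ext_in_def by blast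
    obtain l j where l: "t = trunc l t'" "j \<ge> l" "t' j \<noteq> 0"
      using tt unfolding ext_in_def ext_def by blast
    have I': "I t'" using d unfolding I_def D'_def trunc_def by auto
    have "j \<ge> m" using I' l(3) unfolding I_def by (meson not_le)
    then have "\<phi> t' j \<noteq> 0" using l(3) m s by (simp add: \<phi>_def)
    \<comment> \<open>Cutting at \<open>max l m\<close> keeps all of \<open>x\<close>, even when
      \<open>t\<close> is cut earlier.\<close>
    moreover have "\<phi> t = trunc (max l m) (\<phi> t')"
      using l(1) m I' unfolding \<phi>_def trunc_def I_def by (auto simp: fun_eq_iff)
    ultimately have "ext (\<phi> t) (\<phi> t')"
      using l(2) \<open>j \<ge> m\<close> unfolding ext_def by (meson max.boundedI)
    moreover have "\<phi> t' = trunc (max k m) (\<lambda>j. x j + s * d j)"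
      using d m unfolding \<phi>_def trunc_def D'_def by (auto simp: fun_eq_iff)
    ultimately show ?thesis using I' d(1) unfolding ext_in_def D'_def by blast
  qed
  have "sim bounded_ext (ext_in D) w (\<phi> (\<lambda>_. 0))"
    by (rule sim_map[where I = I and f = \<phi>, OF rank[OF D']]) (use step in \<open>auto simp: I_def\<close>)
  moreover have "\<phi> (\<lambda>_. 0) = x" unfolding \<phi>_def by simp
  moreover have "ext_in D x (\<lambda>_. 0)"
  proof -
    obtain y where y: "D' y" using ultra_eventuallyD[OF p(1) D'] by blast
    have "x = trunc m (\<lambda>j. x j + s * y j)"
      using y m unfolding D'_def trunc_def by (auto simp: fun_eq_iff)
    moreover have "ext (\<lambda>_. 0) x"
      using x(2) unfolding ext_def trunc_def by (intro exI[of _ 0]) auto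
    ultimately show ?thesis using y unfolding ext_in_def D'_def by blast
  qed
  ultimately show ?thesis by auto
qed

section \<open>Limits of ultrafilters and unbounded rank\<close>

text \<open>Apart from being ultra, every clause says that some property holds almost surely; such a
  property passes to the limit if almost every \<open>f x\<close> has it.\<close>

lemma normed_ultra_fbind:
  assumes "ultra p" "\<forall>\<^sub>F x in p. normed_ultra (f x)"
  shows "normed_ultra (fbind p f)"
proof -
  have ev: "eventually Q (fbind p f)" if "\<And>q. normed_ultra q \<Longrightarrow> eventually Q q" for Q
    unfolding eventually_fbind using assms(2) by (rule eventually_mono) (rule that)
  have "ultra (fbind p f)"
    by (rule ultra_fbind[OF assms(1) eventually_mono[OF assms(2)]]) (rule normed_ultraD)
  then show ?thesis
    unfolding normed_ultra_def
    using ev[OF normed_ultraD(2)] ev[OF normed_ultraD(3)] ev[OF normed_ultraD(4)]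
      ev[OF normed_ultraD(5)]
    by blast
qed

text \<open>
  The ultrafilter for \<open>w\<close> is a limit of doubled ultrafilters for the successors \<open>w'\<close>, taken along
  an ultrafilter on the successors that contains every final segment of the total rank preorder.
\<close>

lemma rank_unbounded:
  "\<exists>p. normed_ultra p \<and> (\<forall>D. eventually D p \<longrightarrow> sim bounded_ext (ext_in D) w (\<lambda>_. 0))"
proof (induction w rule: wfp_induct_rule[OF wfp_bounded_ext])
  case (1 w)
  show ?case
  proof (cases "\<exists>w'. bounded_ext w' w")
    case False
    then show ?thesis using normed_ultra_exists simI[of bounded_ext w "ext_in _"] by blast
  next
    case True
    define W where "W = {w'. bounded_ext w' w}"
    have "W \<noteq> {}" using True unfolding W_def by simp
    \<comment> \<open>Doubling the ultrafilter given by induction makes the rank exceed that of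
      \<open>w'\<close>: a child of the root already dominates \<open>w'\<close>.\<close>
    have "\<exists>q. normed_ultra q \<and> (\<forall>D. eventually D q \<longrightarrow>
        (\<exists>x. ext_in D x (\<lambda>_. 0) \<and> sim bounded_ext (ext_in D) w' x))" if "w' \<in> W" for w'
    proof -
      from 1[of w'] that obtain p where p: "normed_ultra p"
        "\<And>D. eventually D p \<Longrightarrow> sim bounded_ext (ext_in D) w' (\<lambda>_. 0)" unfolding W_def by blast
      obtain s where s: "s \<in> {1, -1}" "normed_ultra (double s p)"
        using sign_exists[OF p(1)] normed_ultra_double[OF p(1)] by metis
      show ?thesis using s(2) rank_less_double[OF p(1) s(1) p(2)] by blast
    qed
    then obtain q where q: "\<And>w'. w' \<in> W \<Longrightarrow> normed_ultra (q w')"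
      "\<And>w' D. w' \<in> W \<Longrightarrow> eventually D (q w') \<Longrightarrow>
        \<exists>x. ext_in D x (\<lambda>_. 0) \<and> sim bounded_ext (ext_in D) w' x"
      by metis
    define up where "up a = principal {b \<in> W. sim bounded_ext bounded_ext a b}" for a
    have refl: "sim bounded_ext bounded_ext a a" for a
      using sim_total[OF wfp_bounded_ext] by blast
    \<comment> \<open>Totality of the rank preorder makes the final segments directed, hence a
      filter base.\<close>
    have base: "eventually P (INF a\<in>W. up a) \<longleftrightarrow> (\<exists>a\<in>W. eventually P (up a))" for P
    proof (rule eventually_INF_base[OF \<open>W \<noteq> {}\<close>])
      fix a b assume "a \<in> W" "b \<in> W"
      have mono: "up d \<le> up c" if "sim bounded_ext bounded_ext c d" for c d
        using sim_trans[OF that] unfolding up_def by auto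
      show "\<exists>c\<in>W. up c \<le> inf (up a) (up b)"
        using sim_total[OF wfp_bounded_ext, of a b] mono \<open>a \<in> W\<close> \<open>b \<in> W\<close> by (meson le_inf_iff order_refl)
    qed
    have "(INF a\<in>W. up a) \<noteq> bot"
      using base[of "\<lambda>_. False"] refl by (auto simp: trivial_limit_def up_def eventually_principal)
    then obtain r where r: "r \<le> (INF a\<in>W. up a)" "ultra r"
      using ultra_exists by blast
    have above: "\<forall>\<^sub>F b in r. b \<in> W \<and> sim bounded_ext bounded_ext a b" if "a \<in> W" for a
      by (rule filter_leD[OF r(1)]) (use base that in \<open>auto simp: up_def eventually_principal\<close>)
    have inW: "\<forall>\<^sub>F b in r. b \<in> W"
    proof -
      obtain a where "a \<in> W" using \<open>W \<noteq> {}\<close> by blast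
      from above[OF this] show ?thesis by eventually_elim simp
    qed
    have "normed_ultra (fbind r q)"
      by (rule normed_ultra_fbind[OF r(2)]) (use inW q(1) in \<open>auto elim: eventually_mono\<close>)
    moreover have "sim bounded_ext (ext_in D) w (\<lambda>_. 0)" if D: "eventually D (fbind r q)" for D
    proof (intro sim.simI allI impI)
      fix w' assume "bounded_ext w' w"
      then have "w' \<in> W" unfolding W_def by simp
      \<comment> \<open>Almost every \<open>b\<close> dominates \<open>w'\<close> and has
        \<open>D\<close> large for \<open>q b\<close>; the child found for one such \<open>b\<close>
        then dominates \<open>w'\<close> by transitivity.\<close>
      have "\<forall>\<^sub>F b in r. b \<in> W \<and> sim bounded_ext bounded_ext w' b \<and> eventually D (q b)"
        using above[OF \<open>w' \<in> W\<close>] D unfolding eventually_fbind by eventually_elim simp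
      from ultra_eventuallyD[OF r(2) this] obtain b where b: "b \<in> W" "sim bounded_ext bounded_ext w' b" "eventually D (q b)"
        by blast
      from q(2)[OF b(1,3)] obtain x where "ext_in D x (\<lambda>_. 0)" "sim bounded_ext (ext_in D) b x"
        by (elim exE conjE)
      with sim_trans[OF b(2), of "ext_in D" x]
      show "\<exists>x. ext_in D x (\<lambda>_. 0) \<and> sim bounded_ext (ext_in D) w' x" by (intro exI conjI)
    qed
    ultimately show ?thesis by blast
  qed
qed

text \<open>An ultrafilter of rank at least that of the root is doubled once more. Its typical norms
  are at most 2, so the tree of \<open>D\<close> lies inside the bounded tree, where a child of the
  root would dominate the root.\<close>

lemma unseparated_sequence_False: False
proof -
  obtain p where p: "normed_ultra p" "\<And>D. eventually D p \<Longrightarrow> sim bounded_ext (ext_in D) (\<lambda>_. 0) (\<lambda>_. 0)"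
    using rank_unbounded by blast
  obtain s where s: "s \<in> {1, -1}" "normed_ultra (double s p)"
    using sign_exists[OF p(1)] normed_ultra_double[OF p(1)] by metis
  define D where "D f \<longleftrightarrow> signed f \<and> norm (lin_comb f) \<le> 2" for f
  have "eventually D (double s p)"
    unfolding D_def using normed_ultraD(2)[OF s(2)] normed_ultraD(5)[OF s(2) zero_less_one] by eventually_elim simp
  from rank_less_double[OF p(1) s(1) p(2) this] obtain x
    where x: "ext_in D x (\<lambda>_. 0)" "sim bounded_ext (ext_in D) (\<lambda>_. 0) x" by blast
  have bounded: "bounded_sums (trunc k d)" if "D d" for d k
  proof -
    have "norm (lin_comb (trunc i d)) \<le> 2 * K" for i
      using norm_lin_comb_trunc[of d i] that mult_left_mono[of "norm (lin_comb d)" 2 K] K_ge_1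
      unfolding D_def by linarith
    then show ?thesis using that unfolding bounded_sums_def D_def by (simp add: signed_trunc trunc_trunc)
  qed
  have sub: "bounded_ext g f" if "ext_in D g f" for f g
    using that bounded unfolding ext_in_def bounded_ext_def by blast
  have "sim bounded_ext bounded_ext (\<lambda>_. 0) (id x)"
    by (rule sim_map[where I = "\<lambda>_. True" and f = id, OF x(2)]) (auto intro: sub)
  with sim_irrefl[OF wfp_bounded_ext, of x "\<lambda>_. 0"] sub[OF x(1)] show False by simp
qed

end

subsection \<open>The basis constant\<close>

text \<open>A common frame for real and complex scalars that keeps the real structure of the type
  compatible with \<open>smul\<close>.\<close>

locale normed_scaling = vector_space smul
  for smul :: "'k::{real_normed_field,banach} \<Rightarrow> 'a::banach \<Rightarrow> 'a" +
  assumes smul_of_real: "smul (of_real r) x = r *\<^sub>R x"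
    and norm_smul: "norm (smul c x) = norm c * norm x"
begin

lemma bounded_linear_smul_left: "bounded_linear (\<lambda>c. smul c x)"
  by (rule bounded_linear_intro[where K = "norm x"])
    (simp_all add: scale_left_distrib norm_smul scaleR_conv_of_real smul_of_real[symmetric])

context
  fixes e :: "nat \<Rightarrow> 'a"
  assumes basic: "basic_sequence smul e"
begin

section \<open>Expansions with bounded partial sums\<close>

text \<open>The closed ball of radius \<open>B\<close> for the norm given by the supremum of the
  norms of the partial sums.\<close>

definition expansions :: "real \<Rightarrow> 'a set"
  where "expansions B = {y. \<exists>a. (\<lambda>j. smul (a j) (e j)) sums y \<and>
    (\<forall>n. norm (\<Sum>j<n. smul (a j) (e j)) \<le> B)}"

lemma expansionsI:
  "(\<lambda>j. smul (a j) (e j)) sums y \<Longrightarrow> (\<And>n. norm (\<Sum>j<n. smul (a j) (e j)) \<le> B) \<Longrightarrow> y \<in> expansions B"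
  unfolding expansions_def by blast

lemma sums_in_closure_span:
  assumes "(\<lambda>j. smul (a j) (e j)) sums y"
  shows "y \<in> closure (span (range e))"
proof -
  have "\<forall>n. (\<Sum>j<n. smul (a j) (e j)) \<in> span (range e)"
    by (intro allI span_sum span_scale span_base) simp
  then show ?thesis
    using assms unfolding sums_def closure_sequential
    by (intro exI[of _ "\<lambda>n. \<Sum>j<n. smul (a j) (e j)"] conjI)
qed

lemma unique_expansion:
  assumes "(\<lambda>j. smul (a j) (e j)) sums y" "(\<lambda>j. smul (b j) (e j)) sums y"
  shows "a = b"
  using basic sums_in_closure_span[OF assms(1)] assms
  unfolding basic_sequence_def schauder_basis_of_def by blast

text \<open>A zero basis vector would give 0 two different expansions.\<close>

lemma basis_nonzero: "e j \<noteq> 0"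
proof
  assume "e j = 0"
  then have "smul (if i = j then 1 else 0) (e i) = 0" for i by simp
  then have "(\<lambda>i. smul ((\<lambda>i. if i = j then 1 else 0) i) (e i)) sums 0" by (simp only: sums_zero)
  moreover have "(\<lambda>i. smul ((\<lambda>_. 0) i) (e i)) sums 0" by simp
  ultimately have "(\<lambda>i. if i = j then 1 else 0 :: 'k) = (\<lambda>_. 0)" by (rule unique_expansion)
  then show False by (metis zero_neq_one)
qed

lemma Union_expansions: "(\<Union>n. expansions (real n)) = closure (span (range e))"
proof (intro subset_antisym subsetI)
  fix y assume "y \<in> (\<Union>n. expansions (real n))"
  then obtain a where a: "(\<lambda>j. smul (a j) (e j)) sums y" unfolding expansions_def by blast
  then show "y \<in> closure (span (range e))" by (rule sums_in_closure_span)
next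
  fix y assume "y \<in> closure (span (range e))"
  with basic obtain a where a: "(\<lambda>j. smul (a j) (e j)) sums y"
    unfolding basic_sequence_def schauder_basis_of_def by blast
  then have "Bseq (\<lambda>n. \<Sum>j<n. smul (a j) (e j))"
    unfolding sums_def by (intro convergent_imp_Bseq convergentI)
  then obtain B where B: "\<And>n. norm (\<Sum>j<n. smul (a j) (e j)) \<le> B"
    unfolding Bseq_def by blast
  obtain n where "B \<le> real n" using real_arch_simple by blast
  with B have "\<forall>k. norm (\<Sum>j<k. smul (a j) (e j)) \<le> real n"
    by (meson order_trans)
  with a show "y \<in> (\<Union>n. expansions (real n))" unfolding expansions_def by blast
qed

lemma expansions_diff:
  assumes "x \<in> expansions A" "y \<in> expansions B"
  shows "x - y \<in> expansions (A + B)"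
proof -
  obtain a b where a: "(\<lambda>j. smul (a j) (e j)) sums x" "\<And>n. norm (\<Sum>j<n. smul (a j) (e j)) \<le> A"
    and b: "(\<lambda>j. smul (b j) (e j)) sums y" "\<And>n. norm (\<Sum>j<n. smul (b j) (e j)) \<le> B"
    using assms unfolding expansions_def by blast
  have "(\<lambda>j. smul (a j - b j) (e j)) sums (x - y)"
    using sums_diff[OF a(1) b(1)] by (simp add: scale_left_diff_distrib)
  moreover have "norm (\<Sum>j<n. smul (a j - b j) (e j)) \<le> A + B" for n
    using norm_triangle_ineq4[of "\<Sum>j<n. smul (a j) (e j)" "\<Sum>j<n. smul (b j) (e j)"] a(2)[of n] b(2)[of n]
    by (simp add: scale_left_diff_distrib sum_subtractf)
  ultimately show ?thesis by (rule expansionsI)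
qed

lemma expansions_scaleR:
  assumes "x \<in> expansions A"
  shows "t *\<^sub>R x \<in> expansions (\<bar>t\<bar> * A)"
proof -
  obtain a where a: "(\<lambda>j. smul (a j) (e j)) sums x" "\<And>n. norm (\<Sum>j<n. smul (a j) (e j)) \<le> A"
    using assms unfolding expansions_def by blast
  have eq: "smul (of_real t * a j) (e j) = t *\<^sub>R smul (a j) (e j)" for j
    by (simp add: scale_scale[symmetric] smul_of_real del: scale_scale)
  have "(\<lambda>j. smul (of_real t * a j) (e j)) sums (t *\<^sub>R x)"
    unfolding eq by (rule sums_scaleR_right[OF a(1)])
  moreover have "norm (\<Sum>j<n. smul (of_real t * a j) (e j)) \<le> \<bar>t\<bar> * A" for n
    unfolding eq scaleR_sum_right[symmetric] using a(2)[of n] by (simp add: mult_left_mono)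
  ultimately show ?thesis by (rule expansionsI)
qed

lemma closure_span_iff: "y \<in> closure (span (range e)) \<longleftrightarrow> (\<exists>n. y \<in> expansions (real n))"
  using Union_expansions by blast

lemma closure_span_diff:
  assumes "x \<in> closure (span (range e))" "y \<in> closure (span (range e))"
  shows "x - y \<in> closure (span (range e))"
  using assms unfolding closure_span_iff by (metis expansions_diff of_nat_add)

lemma expansions_subset: "expansions B \<subseteq> closure (span (range e))"
proof
  fix y assume "y \<in> expansions B"
  moreover obtain n where "B \<le> real n" using real_arch_simple by blast
  ultimately have "y \<in> expansions (real n)" unfolding expansions_def using order_trans by blast
  then show "y \<in> closure (span (range e))" using closure_span_iff by blast
qed

section \<open>Baire category and successive approximation\<close>

text \<open>By Baire, the closure of some \<open>expansions (real n)\<close> has interior in the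
  closed span. Differences move that interior to a ball about 0, and scaling gives all
  \<open>t\<close>.\<close>

lemma expansions_dense:
  obtains r B :: real where "r > 0" "B \<ge> 0"
    "\<And>t y. t > 0 \<Longrightarrow> y \<in> closure (span (range e)) \<Longrightarrow> norm y < t * r \<Longrightarrow> y \<in> closure (expansions (t * B))"
proof -
  define Y where "Y = closure (span (range e))"
  have Y0: "0 \<in> Y" unfolding Y_def using closure_subset span_zero by blast
  have Y_scale: "t *\<^sub>R y \<in> Y" if y: "y \<in> Y" for t y
  proof -
    from y obtain n where "y \<in> expansions (real n)" unfolding Y_def closure_span_iff by blast
    then show ?thesis using expansions_scaleR expansions_subset unfolding Y_def by blast
  qed
  have "\<exists>n. (top_of_set Y) interior_of (closure (expansions (real n))) \<noteq> {}"
  proof (rule ccontr)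
    assume *: "\<not> ?thesis"
    have "closed Y" unfolding Y_def by simp
    have "completely_metrizable_space (top_of_set Y)"
      using completely_metrizable_space_closedin[OF completely_metrizable_space_euclidean] \<open>closed Y\<close> by simp
    then have "(top_of_set Y) interior_of \<Union>(range (\<lambda>n. closure (expansions (real n)))) = {}"
    proof (intro Baire_category_alt disjI1)
      fix T assume "T \<in> range (\<lambda>n. closure (expansions (real n)))"
      then obtain n where T: "T = closure (expansions (real n))" by blast
      have "T \<subseteq> Y" unfolding T Y_def by (intro closure_minimal expansions_subset) simp
      then have "closedin (top_of_set Y) T" unfolding T by (intro closed_subset) auto
      then show "closedin (top_of_set Y) T \<and> (top_of_set Y) interior_of T = {}" using * T by blast
    qed auto
    moreover have "Y \<subseteq> \<Union>(range (\<lambda>n. closure (expansions (real n))))"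
      unfolding Y_def Union_expansions[symmetric] using closure_subset by blast
    then have "Y \<subseteq> (top_of_set Y) interior_of \<Union>(range (\<lambda>n. closure (expansions (real n))))"
      using openin_subtopology_self unfolding interior_of_def by blast
    ultimately show False using Y0 by blast
  qed
  then obtain n T y0 where T: "openin (top_of_set Y) T" "y0 \<in> T" "T \<subseteq> closure (expansions (real n))"
    unfolding interior_of_def by blast
  then have "y0 \<in> Y" by (meson openin_imp_subset subsetD)
  from T(1,2) obtain r where r: "r > 0" "ball y0 r \<inter> Y \<subseteq> T"
    unfolding openin_contains_ball by blast
  \<comment> \<open>Here \<open>y\<close> is the difference of \<open>y0 + y\<close> and
    \<open>y0\<close>, both approximable with bound \<open>n\<close>; hence the doubled
    bound.\<close>
  have *: "y \<in> closure (expansions (real n + real n))" if y: "y \<in> Y" "norm y < r" for y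
    unfolding closure_approachable
  proof (intro allI impI)
    fix \<delta> :: real assume "\<delta> > 0"
    have "y0 - (- 1) *\<^sub>R y \<in> Y"
      using closure_span_diff \<open>y0 \<in> Y\<close> Y_scale[OF y(1)] unfolding Y_def by blast
    then have "y0 + y \<in> ball y0 r \<inter> Y" using y by (simp add: dist_norm)
    then have "y0 + y \<in> closure (expansions (real n))" "y0 \<in> closure (expansions (real n))"
      using r T by blast+
    with \<open>\<delta> > 0\<close> obtain p q where pq: "p \<in> expansions (real n)" "dist p (y0 + y) < \<delta> / 2"
      "q \<in> expansions (real n)" "dist q y0 < \<delta> / 2"
      unfolding closure_approachable by (meson half_gt_zero)
    have "p - q - y = (p - (y0 + y)) - (q - y0)" by simp
    then have "dist (p - q) y \<le> dist p (y0 + y) + dist q y0"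
      unfolding dist_norm by (simp only: norm_triangle_ineq4)
    with pq(2,4) have "dist (p - q) y < \<delta>" by linarith
    with expansions_diff[OF pq(1,3)] show "\<exists>z\<in>expansions (real n + real n). dist z y < \<delta>" by blast
  qed
  have "y \<in> closure (expansions (t * (real n + real n)))" if t: "t > 0" and y: "y \<in> Y" "norm y < t * r" for t y
  proof -
    have "norm (inverse t *\<^sub>R y) < r" using t y by (simp add: field_simps)
    from *[OF Y_scale[OF y(1)] this]
    have "t *\<^sub>R inverse t *\<^sub>R y \<in> (*\<^sub>R) t ` closure (expansions (real n + real n))" by (rule imageI)
    then have "y \<in> closure ((*\<^sub>R) t ` expansions (real n + real n))"
      using t by (simp add: closure_scaleR)
    moreover have "(*\<^sub>R) t ` expansions (real n + real n) \<subseteq> expansions (t * (real n + real n))"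
      using expansions_scaleR[of _ "real n + real n" t] t by auto
    ultimately show ?thesis using closure_mono by blast
  qed
  with r(1) show ?thesis
    by (intro that[of r "real n + real n"]) (auto simp: Y_def)
qed

text \<open>
  The coefficients of \<open>y\<close> are the sums of those of the \<open>x i\<close>; the partial sums converge uniformly in
  the length, so the two limits may be interchanged.
\<close>

lemma expansions_series:
  assumes x: "\<And>i. x i \<in> expansions (M i)" and M: "summable M" and y: "x sums y"
  shows "y \<in> expansions (suminf M)"
proof -
  from x obtain a where a: "\<And>i. (\<lambda>j. smul (a i j) (e j)) sums x i"
    and bound: "\<And>i n. norm (\<Sum>j<n. smul (a i j) (e j)) \<le> M i"
    unfolding expansions_def by simp metis
  have M0: "M i \<ge> 0" for i using bound[where i = i and n = 0] by simp
  \<comment> \<open>A single term is the difference of two consecutive partial sums, so its norm is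
    at most \<open>2 * M i\<close>.\<close>
  have summable_a: "summable (\<lambda>i. a i j)" for j
  proof (rule summable_comparison_test')
    show "summable (\<lambda>i. 2 * M i / norm (e j))" using M by (intro summable_mult summable_divide)
    fix i
    have "smul (a i j) (e j) = (\<Sum>j<Suc j. smul (a i j) (e j)) - (\<Sum>j<j. smul (a i j) (e j))" by simp
    then have "norm (smul (a i j) (e j)) \<le> norm (\<Sum>j<Suc j. smul (a i j) (e j)) + norm (\<Sum>j<j. smul (a i j) (e j))"
      by (metis norm_triangle_ineq4)
    also have "\<dots> \<le> M i + M i" by (intro add_mono bound)
    finally have "norm (smul (a i j) (e j)) \<le> M i + M i" .
    then show "norm (a i j) \<le> 2 * M i / norm (e j)"
      using basis_nonzero[of j] by (simp add: norm_smul field_simps)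
  qed
  define b where "b j = (\<Sum>i. a i j)" for j
  define P where "P i n = (\<Sum>j<n. smul (a i j) (e j))" for i n
  have P_sums: "(\<lambda>i. P i n) sums (\<Sum>j<n. smul (b j) (e j))" for n
    unfolding P_def b_def
    by (intro sums_sum bounded_linear.sums[OF bounded_linear_smul_left] summable_sums summable_a)
  have "uniform_limit UNIV (\<lambda>I n. \<Sum>i<I. P i n) (\<lambda>n. \<Sum>i. P i n) sequentially"
    using bound M by (intro Weierstrass_m_test) (auto simp: P_def)
  then have unif: "uniform_limit UNIV (\<lambda>I n. \<Sum>i<I. P i n) (\<lambda>n. \<Sum>j<n. smul (b j) (e j)) sequentially"
    using P_sums by (simp add: sums_iff)
  have lim: "(\<lambda>n. \<Sum>i<I. P i n) \<longlonglongrightarrow> (\<Sum>i<I. x i)" for I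
    using a unfolding P_def sums_def by (intro tendsto_sum)
  have "(\<lambda>n. \<Sum>j<n. smul (b j) (e j)) \<longlonglongrightarrow> y"
    by (rule swap_uniform_limit'[OF always_eventually[OF allI[OF lim]] y[unfolded sums_def] unif]) simp_all
  moreover have "norm (\<Sum>j<n. smul (b j) (e j)) \<le> suminf M" for n
  proof -
    have "norm (\<Sum>i. P i n) \<le> suminf M"
      using bound M by (intro norm_suminf_le) (auto simp: P_def)
    then show ?thesis using P_sums by (simp add: sums_iff)
  qed
  ultimately show ?thesis by (intro expansionsI[where a = b]) (simp_all add: sums_def)
qed

text \<open>Successive approximation, as in the open mapping theorem, removes the closure.\<close>

lemma expansions_ball:
  obtains r B :: real where "r > 0" "\<And>y. y \<in> closure (span (range e)) \<Longrightarrow> norm y < r \<Longrightarrow> y \<in> expansions B"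
proof -
  obtain r B :: real where r: "r > 0" "B \<ge> 0" and dense: "\<And>t y. t > 0 \<Longrightarrow> y \<in> closure (span (range e)) \<Longrightarrow>
      norm y < t * r \<Longrightarrow> y \<in> closure (expansions (t * B))"
    using expansions_dense by metis
  define Y where "Y = closure (span (range e))"
  \<comment> \<open>Density at scale \<open>(1/2)^i\<close> halves the bound on the
    remainder.\<close>
  have step: "\<exists>p. p \<in> expansions ((1/2)^i * B) \<and> y - p \<in> Y \<and> norm (y - p) < (1/2)^Suc i * r"
    if y: "y \<in> Y" "norm y < (1/2)^i * r" for y i
  proof -
    have "y \<in> closure (expansions ((1/2)^i * B))" using dense[of "(1/2)^i" y] y unfolding Y_def by simp
    moreover have "(1/2)^Suc i * r > 0" using r by simp
    ultimately obtain p where "p \<in> expansions ((1/2)^i * B)" "dist p y < (1/2)^Suc i * r"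
      unfolding closure_approachable by blast
    moreover from this have "y - p \<in> Y"
      using closure_span_diff expansions_subset y(1) unfolding Y_def by blast
    ultimately show ?thesis by (auto simp: dist_norm norm_minus_commute)
  qed
  have "y \<in> expansions (\<Sum>i. (1/2)^i * B)" if y: "y \<in> Y" "norm y < r" for y
  proof -
    \<comment> \<open>\<open>z i\<close> is the remainder after \<open>i\<close> approximations; the
      differences are the approximants and telescope to \<open>y\<close>.\<close>
    have "\<exists>z. \<forall>i. (z i \<in> Y \<and> norm (z i) < (1/2)^i * r \<and> (i = 0 \<longrightarrow> z i = y)) \<and>
        z i - z (Suc i) \<in> expansions ((1/2)^i * B)"
    proof (rule dependent_nat_choice)
      show "\<exists>x. x \<in> Y \<and> norm x < (1/2)^0 * r \<and> (0 = (0::nat) \<longrightarrow> x = y)" using y by simp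
      fix x i assume "x \<in> Y \<and> norm x < (1/2)^i * r \<and> (i = 0 \<longrightarrow> x = y)"
      with step[of x i] obtain p where "p \<in> expansions ((1/2)^i * B)" "x - p \<in> Y"
        "norm (x - p) < (1/2)^Suc i * r" by blast
      then show "\<exists>w. (w \<in> Y \<and> norm w < (1/2)^Suc i * r \<and> (Suc i = 0 \<longrightarrow> w = y)) \<and>
          x - w \<in> expansions ((1/2)^i * B)"
        by (intro exI[of _ "x - p"]) simp
    qed
    then obtain z where z: "\<And>i. norm (z i) < (1/2)^i * r" "z 0 = y"
      "\<And>i. z i - z (Suc i) \<in> expansions ((1/2)^i * B)" by blast
    have "(\<lambda>i. (1/2)^i * r) \<longlonglongrightarrow> 0 * r" by (intro tendsto_mult LIMSEQ_power_zero tendsto_const) simp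
    then have "(\<lambda>i. (1/2)^i * r) \<longlonglongrightarrow> 0" by simp
    then have "z \<longlonglongrightarrow> 0"
      by (rule Lim_null_comparison[rotated]) (use z(1) in \<open>auto intro: always_eventually less_imp_le\<close>)
    then have "(\<lambda>i. z i - z (Suc i)) sums (z 0 - 0)" by (rule telescope_sums')
    then have "(\<lambda>i. z i - z (Suc i)) sums y" using z(2) by simp
    with z(3) show ?thesis by (intro expansions_series summable_mult2 summable_geometric) auto
  qed
  with r(1) show ?thesis by (intro that[of r "\<Sum>i. (1/2)^i * B"]) (auto simp: Y_def)
qed

text \<open>Rescaled into the small ball, a finite combination has an expansion with partial sums
  bounded by \<open>B\<close>; by uniqueness these are its own partial sums.\<close>

lemma basis_constant:
  obtains C where "\<And>c k m. k \<le> m \<Longrightarrow>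
    norm (\<Sum>j<k. smul (c j) (e j)) \<le> C * norm (\<Sum>j<m. smul (c j) (e j))"
proof -
  obtain r B where r: "r > 0"
    and ball: "\<And>y. y \<in> closure (span (range e)) \<Longrightarrow> norm y < r \<Longrightarrow> y \<in> expansions B"
    by (rule expansions_ball) (rule that)
  have "norm (\<Sum>j<k. smul (c j) (e j)) \<le> (2 * B / r) * norm (\<Sum>j<m. smul (c j) (e j))"
    if "k \<le> m" for c k m
  proof -
    define y where "y = (\<Sum>j<m. smul (c j) (e j))"
    \<comment> \<open>Padding with zeros turns the finite combination into an infinite expansion, to
      which uniqueness applies.\<close>
    define d where "d j = (if j < m then c j else 0)" for j
    have sum_d: "(\<Sum>j<i. smul (d j) (e j)) = (\<Sum>j<i. smul (c j) (e j))" if "i \<le> m" for i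
      using that by (intro sum.cong) (auto simp: d_def)
    have d: "(\<lambda>j. smul (d j) (e j)) sums y"
      using sums_finite[of "{..<m}" "\<lambda>j. smul (d j) (e j)"] sum_d[of m] by (simp add: d_def y_def)
    show ?thesis
    proof (cases "y = 0")
      case True
      then have "d = (\<lambda>_. 0)" using unique_expansion[of d y "\<lambda>_. 0"] d by simp
      then have "(\<Sum>j<k. smul (c j) (e j)) = 0" using sum_d[OF \<open>k \<le> m\<close>] by simp
      with True show ?thesis by (simp add: y_def)
    next
      case False
      \<comment> \<open>This gives \<open>t *\<^sub>R y\<close> the norm \<open>r / 2\<close>,
        strictly inside the ball.\<close>
      define t where "t = r / (2 * norm y)"
      have t: "t > 0" using False r by (simp add: t_def)
      have "y \<in> span (range e)"
        unfolding y_def by (intro span_sum span_scale span_base) simp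
      then have "smul (of_real t) y \<in> closure (span (range e))"
        using closure_subset span_scale by blast
      moreover have "norm (t *\<^sub>R y) < r" using False r by (simp add: t_def)
      ultimately have "t *\<^sub>R y \<in> expansions B" using ball by (simp add: smul_of_real)
      then obtain a where a: "(\<lambda>j. smul (a j) (e j)) sums (t *\<^sub>R y)"
        "\<And>n. norm (\<Sum>j<n. smul (a j) (e j)) \<le> B" unfolding expansions_def by blast
      have eq: "smul (of_real t * d j) (e j) = t *\<^sub>R smul (d j) (e j)" for j
        by (simp add: scale_scale[symmetric] smul_of_real del: scale_scale)
      have "(\<lambda>j. smul (of_real t * d j) (e j)) sums (t *\<^sub>R y)"
        unfolding eq by (rule sums_scaleR_right[OF d])
      with a(1) have "a = (\<lambda>j. of_real t * d j)" by (rule unique_expansion)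
      with a(2)[of k] have "t * norm (\<Sum>j<k. smul (c j) (e j)) \<le> B"
        using t by (simp add: eq scaleR_sum_right[symmetric] sum_d[OF \<open>k \<le> m\<close>])
      then show ?thesis
        using False r unfolding t_def y_def[symmetric] by (simp add: field_simps)
    qed
  qed
  then show ?thesis using that by blast
qed

end

section \<open>Conclusion for both scalar fields\<close>

lemma separated_of_boundedly_complete:
  assumes basic: "basic_sequence smul e" and complete: "boundedly_complete smul e"
  shows "\<exists>\<epsilon>>0. \<exists>x :: nat \<Rightarrow> 'a. range x \<subseteq> sphere 0 1 \<and> symmetrically_separated (1 + \<epsilon>) x"
proof (rule ccontr)
  assume no_sep: "\<not> ?thesis"
  obtain C where C: "\<And>c k m. k \<le> m \<Longrightarrow>
    norm (\<Sum>j<k. smul (c j) (e j)) \<le> C * norm (\<Sum>j<m. smul (c j) (e j))"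
    by (rule basis_constant[OF basic]) (rule that)
  \<comment> \<open>Normalising divides the coefficients by \<open>norm (e j)\<close>, so real
    combinations of \<open>v\<close> are \<open>smul\<close> combinations of
    \<open>e\<close>.\<close>
  define v where "v j = e j /\<^sub>R norm (e j)" for j
  have v: "f j *\<^sub>R v j = smul (of_real (f j / norm (e j))) (e j)" for f :: "nat \<Rightarrow> real" and j
    unfolding v_def smul_of_real by (simp add: field_simps)
  interpret unseparated_sequence v C
  proof
    show "norm (v j) = 1" for j using basis_nonzero[OF basic] by (simp add: v_def)
    show "norm (\<Sum>j<k. f j *\<^sub>R v j) \<le> C * norm (\<Sum>j<m. f j *\<^sub>R v j)" if "k \<le> m" for f k m
      unfolding v by (rule C[OF that])
    show "(\<lambda>j. f j *\<^sub>R v j) \<longlonglongrightarrow> 0" if "bdd_above (range (\<lambda>m. norm (\<Sum>j<m. f j *\<^sub>R v j)))" for f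
    proof -
      \<comment> \<open>Sums up to and including \<open>m\<close> are the strict sums up to
        \<open>Suc m\<close>, which reconciles the two indexings.\<close>
      have "range (\<lambda>m. norm (\<Sum>j\<le>m. f j *\<^sub>R v j)) \<subseteq> range (\<lambda>m. norm (\<Sum>j<m. f j *\<^sub>R v j))"
        by (auto simp: lessThan_Suc_atMost[symmetric] simp del: sum.lessThan_Suc)
      with that have "bdd_above (range (\<lambda>m. norm (\<Sum>j\<le>m. f j *\<^sub>R v j)))" by (rule bdd_above_mono)
      then have "bdd_above (range (\<lambda>m. norm (\<Sum>j\<le>m. smul (of_real (f j / norm (e j))) (e j))))"
        unfolding v .
      then have "summable (\<lambda>j. smul (of_real (f j / norm (e j))) (e j))"
        using complete[unfolded boundedly_complete_def, rule_format,
            of "\<lambda>j. of_real (f j / norm (e j))"] by simp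
      then show ?thesis unfolding v by (rule summable_LIMSEQ_zero)
    qed
    show "\<not> symmetrically_separated (1 + \<epsilon>) x" if "\<epsilon> > 0" "range x \<subseteq> sphere 0 1" for \<epsilon> and x :: "nat \<Rightarrow> 'a"
      using no_sep that by blast
  qed
  show False by (rule unseparated_sequence_False)
qed

end

theorem theorem1p1:
  "((\<exists>e :: nat \<Rightarrow> 'a::banach. basic_sequence scaleR e \<and> boundedly_complete scaleR e) \<longrightarrow>
      (\<exists>\<epsilon>>0. \<exists>x :: nat \<Rightarrow> 'a. range x \<subseteq> sphere 0 1 \<and> symmetrically_separated (1 + \<epsilon>) x)) \<and>
   (\<forall>cscale :: complex \<Rightarrow> 'b::banach \<Rightarrow> 'b. complex_banach_space cscale \<longrightarrow>
      (\<exists>e :: nat \<Rightarrow> 'b. basic_sequence cscale e \<and> boundedly_complete cscale e) \<longrightarrow>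
      (\<exists>\<epsilon>>0. \<exists>x :: nat \<Rightarrow> 'b. range x \<subseteq> sphere 0 1 \<and> symmetrically_separated (1 + \<epsilon>) x))"
proof (intro conjI impI allI)
  have "normed_scaling (scaleR :: real \<Rightarrow> 'a \<Rightarrow> 'a)"
    by unfold_locales (simp_all add: algebra_simps)
  then show "\<exists>\<epsilon>>0. \<exists>x :: nat \<Rightarrow> 'a. range x \<subseteq> sphere 0 1 \<and> symmetrically_separated (1 + \<epsilon>) x"
    if "\<exists>e :: nat \<Rightarrow> 'a. basic_sequence scaleR e \<and> boundedly_complete scaleR e"
    using that by (elim exE conjE) (rule normed_scaling.separated_of_boundedly_complete)
next
  fix cscale :: "complex \<Rightarrow> 'b \<Rightarrow> 'b"
  assume "complex_banach_space cscale"
  then interpret complex_banach_space cscale .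
  have "normed_scaling cscale"
    by unfold_locales (simp_all add: cscale_of_real norm_cscale)
  then show "\<exists>\<epsilon>>0. \<exists>x :: nat \<Rightarrow> 'b. range x \<subseteq> sphere 0 1 \<and> symmetrically_separated (1 + \<epsilon>) x"
    if "\<exists>e :: nat \<Rightarrow> 'b. basic_sequence cscale e \<and> boundedly_complete cscale e"
    using that by (elim exE conjE) (rule normed_scaling.separated_of_boundedly_complete)
qed

end
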